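(* Let $\Gamma$ be a graph. The rank of $H^*(\Gamma,\mathbf k)$ (in each degree) is independent of the choice of positive integer vertex weights $\mathbf k=\{k_v\}_{v\in V(\Gamma)}$.
   Context: Graphs are finite, without loops or multiple edges. $H^*(\Gamma,\mathbf k)$ is the cohomology of the cochain complex $C^*(\Gamma,\mathbf k)$ with $C^0=\mathbf Z[V(\Gamma)]$, $C^1=\mathbf Z[E(\Gamma)]$ and only nontrivial differential $d^0(v)=\sum_{w} k_w\, e(v,w)$, the sum over neighbours $w$ of $v$, $e(v,w)$ being the edge joining $v$ and $w$. *)

theory Defs
  imports "HOL-Algebra.Algebra" "HOL-Library.Extended_Nat"
begin

locale fin_simple_graph =
  fixes V :: "'a set" and E :: "'a set set"
  assumes finite_verts: "finite V"
    and edges: "e \<in> E \<Longrightarrow> e \<subseteq> V \<and> card e = 2"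

definition neighbours :: "'a set \<Rightarrow> 'a set set \<Rightarrow> 'a \<Rightarrow> 'a set"
  where "neighbours V E v = {w \<in> V. {v, w} \<in> E}"

text \<open>The free generators of the group of \<open>n\<close>-cochains. Vertices and edges are
  embedded into one sum type, so that the groups in all degrees have the same type.\<close>

definition cochain_basis :: "'a set \<Rightarrow> 'a set set \<Rightarrow> int \<Rightarrow> ('a + 'a set) set"
  where "cochain_basis V E n = (if n = 0 then Inl ` V else if n = 1 then Inr ` E else {})"

definition cochain_group ::
    "'a set \<Rightarrow> 'a set set \<Rightarrow> int \<Rightarrow> (('a + 'a set) \<Rightarrow>\<^sub>0 int) monoid"
  where "cochain_group V E n = free_Abelian_group (cochain_basis V E n)"

definition vertex_coboundary ::
    "'a set \<Rightarrow> 'a set set \<Rightarrow> ('a \<Rightarrow> int) \<Rightarrow> 'a \<Rightarrow> (('a + 'a set) \<Rightarrow>\<^sub>0 int)"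
  where "vertex_coboundary V E k v =
    (\<Sum>w \<in> neighbours V E v. frag_cmul (k w) (frag_of (Inr {v, w})))"

text \<open>\<open>coboundary V E k n\<close> is the differential from degree \<open>n\<close> to degree \<open>n + 1\<close>;
  in degree 0 it is the additive extension of \<open>vertex_coboundary\<close>. The value on the
  generators \<open>Inr e\<close> is irrelevant there, as these are not 0-cochains.\<close>

definition coboundary ::
    "'a set \<Rightarrow> 'a set set \<Rightarrow> ('a \<Rightarrow> int) \<Rightarrow> int \<Rightarrow>
      (('a + 'a set) \<Rightarrow>\<^sub>0 int) \<Rightarrow> (('a + 'a set) \<Rightarrow>\<^sub>0 int)"
  where "coboundary V E k n =
    (if n = 0 then frag_extend (case_sum (vertex_coboundary V E k) (\<lambda>e. 0)) else (\<lambda>x. 0))"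

definition cocycles ::
    "'a set \<Rightarrow> 'a set set \<Rightarrow> ('a \<Rightarrow> int) \<Rightarrow> int \<Rightarrow> (('a + 'a set) \<Rightarrow>\<^sub>0 int) set"
  where "cocycles V E k n =
    kernel (cochain_group V E n) (cochain_group V E (n + 1)) (coboundary V E k n)"

definition coboundaries ::
    "'a set \<Rightarrow> 'a set set \<Rightarrow> ('a \<Rightarrow> int) \<Rightarrow> int \<Rightarrow> (('a + 'a set) \<Rightarrow>\<^sub>0 int) set"
  where "coboundaries V E k n =
    coboundary V E k (n - 1) ` carrier (cochain_group V E (n - 1))"

definition cohomology_group ::
    "'a set \<Rightarrow> 'a set set \<Rightarrow> ('a \<Rightarrow> int) \<Rightarrow> int \<Rightarrow> (('a + 'a set) \<Rightarrow>\<^sub>0 int) set monoid"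
  where "cohomology_group V E k n =
    (cochain_group V E n)\<lparr>carrier := cocycles V E k n\<rparr> Mod coboundaries V E k n"

text \<open>The rank of an abelian group, written multiplicatively: the supremum of the sizes
  of its finite subsets that are linearly independent over the integers.\<close>

definition int_independent :: "('b, 'c) monoid_scheme \<Rightarrow> 'b set \<Rightarrow> bool"
  where "int_independent G S \<longleftrightarrow> finite S \<and> S \<subseteq> carrier G \<and>
    (\<forall>c :: 'b \<Rightarrow> int.
      finprod G (\<lambda>x. x [^]\<^bsub>G\<^esub> c x) S = \<one>\<^bsub>G\<^esub> \<longrightarrow> (\<forall>x\<in>S. c x = 0))"

definition group_rank :: "('b, 'c) monoid_scheme \<Rightarrow> enat"
  where "group_rank G = (SUP S \<in> {S. int_independent G S}. enat (card S))"

lemma (in fin_simple_graph) coboundary_hom: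
  "coboundary V E k n \<in> hom (cochain_group V E n) (cochain_group V E (n + 1))"
proof (cases "n = 0")
  case True
  have "vertex_coboundary V E k v \<in> carrier (free_Abelian_group (Inr ` E))" for v
    unfolding vertex_coboundary_def
    by (rule sum_closed_free_Abelian_group)
       (use keys_cmul in \<open>fastforce simp: neighbours_def\<close>)
  then have "case_sum (vertex_coboundary V E k) (\<lambda>e. 0) z
      \<in> carrier (free_Abelian_group (Inr ` E))" for z :: "'a + 'a set"
    by (cases z) auto
  then have "frag_extend (case_sum (vertex_coboundary V E k) (\<lambda>e. 0)) x
      \<in> carrier (free_Abelian_group (Inr ` E))" for x :: "('a + 'a set) \<Rightarrow>\<^sub>0 int"
    unfolding frag_extend_def
    by (intro sum_closed_free_Abelian_group) (use keys_cmul in \<open>fastforce\<close>)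
  with True show ?thesis
    by (simp add: hom_def Pi_def coboundary_def cochain_group_def cochain_basis_def frag_extend_add)
qed (auto simp: hom_def coboundary_def cochain_group_def)

lemma coboundary_coboundary: "coboundary V E k (n + 1) (coboundary V E k n x) = 0"
  by (auto simp: coboundary_def)

lemma (in fin_simple_graph) comm_group_cohomology_group:
  "comm_group (cohomology_group V E k n)"
proof -
  let ?C = "cochain_group V E"
  interpret C: comm_group "?C n"
    by (simp add: cochain_group_def abelian_free_Abelian_group)
  have grp: "group (?C m)" for m
    by (simp add: cochain_group_def)
  interpret d: group_hom "?C n" "?C (n + 1)" "coboundary V E k n"
    using grp coboundary_hom by (simp add: group_hom_def group_hom_axioms_def)
  have hom: "coboundary V E k (n - 1) \<in> hom (?C (n - 1)) (?C n)"
    using coboundary_hom[of k "n - 1"] by simp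
  interpret p: group_hom "?C (n - 1)" "?C n" "coboundary V E k (n - 1)"
    using grp hom by (simp add: group_hom_def group_hom_axioms_def)
  have Z: "subgroup (cocycles V E k n) (?C n)"
    unfolding cocycles_def by (rule d.subgroup_kernel)
  have B: "subgroup (coboundaries V E k n) (?C n)"
    unfolding coboundaries_def by (rule p.img_is_subgroup)
  have BZ: "coboundaries V E k n \<subseteq> cocycles V E k n"
  proof
    fix y assume y: "y \<in> coboundaries V E k n"
    then have "coboundary V E k n y = 0"
      using coboundary_coboundary[of V E k "n - 1"] by (auto simp: coboundaries_def)
    moreover have "y \<in> carrier (?C n)"
      using y subgroup.subset[OF B] by blast
    ultimately show "y \<in> cocycles V E k n"
      unfolding cocycles_def kernel_def by (simp add: cochain_group_def)
  qed
  have Zc: "comm_group ((?C n)\<lparr>carrier := cocycles V E k n\<rparr>)"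
    by (rule group.group_comm_groupI[OF C.subgroup_imp_group[OF Z]])
       (use subgroup.subset[OF Z] C.m_comm in auto)
  moreover have "subgroup (coboundaries V E k n) ((?C n)\<lparr>carrier := cocycles V E k n\<rparr>)"
    using C.subgroup_incl[OF B Z BZ] .
  ultimately show ?thesis
    unfolding cohomology_group_def by (intro comm_group.abelian_FactGroup)
qed

end

theory Submission
  imports Defs
begin

text \<open>
  In the bases of vertices and edges the differential has entry \<open>k w\<close> at the edge \<open>{v, w}\<close>
  and the vertex \<open>v\<close>. Writing \<open>k w = (k v * k w) / k v\<close> exhibits it as the unsigned incidence
  matrix of the graph, with rows and columns multiplied by nonzero rationals, so over the
  rationals the complexes for all weights are isomorphic.

  To stay over the integers, clear denominators: multiply the basis element with vertex set
  \<open>A\<close> (a singleton or an edge) by the product of \<open>k' u\<close> over \<open>u \<in> A\<close> and \<open>k u\<close> over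
  \<open>u \<in> V - A\<close>. This is a cochain map from the complex for \<open>k\<close> to the complex for \<open>k'\<close>
  (\<open>coboundary_rescale\<close>). Its composite with the same map for the exchanged weights is
  multiplication by the nonzero integer \<open>N\<close>, the product of all \<open>k u * k' u\<close>
  (\<open>rescale_rescale\<close>). Hence on cohomology its image contains \<open>N\<close> times every class, and a
  homomorphism with this property cannot raise the rank
  (\<open>group_rank_le_of_torsion_cokernel\<close>). Exchanging the weights gives equality.
\<close>

section \<open>Rank and homomorphisms with torsion cokernel\<close>

lemma (in group_hom) hom_finprod:
  assumes "comm_group G" and "comm_group H" and "f \<in> A \<rightarrow> carrier G"
  shows "h (finprod G f A) = finprod H (\<lambda>x. h (f x)) A"
proof -
  interpret G: comm_group G by fact
  interpret H: comm_group H by fact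
  show ?thesis
    using assms(3)
    by (induction A rule: infinite_finite_induct) (auto simp: Pi_def)
qed

text \<open>Two distinct members of \<open>S\<close> with equal \<open>N\<close>-th powers would satisfy the nontrivial
  relation with exponents \<open>N\<close> and \<open>- N\<close>. The rank counts independent sets, not
  families, so this is what keeps cardinalities equal when lifting along a homomorphism.\<close>

lemma (in comm_group) int_independent_inj_on_pow:
  assumes S: "int_independent G S" and N: "N \<noteq> (0::int)"
  shows "inj_on (\<lambda>x. x [^] N) S"
proof (rule inj_onI, rule ccontr)
  fix x y assume xy: "x \<in> S" "y \<in> S" "x [^] N = y [^] N" "x \<noteq> y"
  have fin: "finite S" and car: "S \<subseteq> carrier G"
    using S by (auto simp: int_independent_def)
  define c where "c = (\<lambda>z. if z = x then N else if z = y then - N else 0)"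
  have "finprod G (\<lambda>z. z [^] c z) S = finprod G (\<lambda>z. z [^] c z) {x, y}"
    by (rule finprod_mono_neutral_cong_right) (use xy fin car in \<open>auto simp: c_def\<close>)
  also have "\<dots> = x [^] N \<otimes> y [^] (- N)"
    using xy car by (subst finprod_insert) (auto simp: c_def)
  also have "\<dots> = \<one>"
    using xy car by (simp add: int_pow_neg subset_iff)
  finally have "c x = 0"
    using S xy(1) by (auto simp: int_independent_def)
  with N show False
    by (simp add: c_def)
qed

text \<open>Lift the \<open>N\<close>-th powers of an independent set of \<open>H\<close> to \<open>G\<close>. Mapping a relation with
  exponents \<open>c\<close> among the lifts back to \<open>H\<close> gives a relation with exponents \<open>N * c\<close> in the
  original set, and these vanish only if \<open>c\<close> does.\<close>

lemma (in group_hom) group_rank_le_of_torsion_cokernel: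
  assumes "comm_group G" and "comm_group H"
    and N: "N \<noteq> (0::int)"
    and range: "\<And>y. y \<in> carrier H \<Longrightarrow> \<exists>x\<in>carrier G. h x = y [^]\<^bsub>H\<^esub> N"
  shows "group_rank H \<le> group_rank G"
  unfolding group_rank_def
proof (rule SUP_mono)
  interpret G: comm_group G by fact
  interpret H: comm_group H by fact
  fix S assume "S \<in> {S. int_independent H S}"
  then have S: "int_independent H S" by simp
  then have fin: "finite S" and car: "S \<subseteq> carrier H"
    and indep: "\<And>c. finprod H (\<lambda>x. x [^]\<^bsub>H\<^esub> c x) S = \<one>\<^bsub>H\<^esub> \<Longrightarrow> \<forall>x\<in>S. c x = (0::int)"
    by (auto simp: int_independent_def)
  have "\<forall>y\<in>S. \<exists>x. x \<in> carrier G \<and> h x = y [^]\<^bsub>H\<^esub> N"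
    using range car by blast
  then obtain l where l: "\<And>y. y \<in> S \<Longrightarrow> l y \<in> carrier G"
    and hl: "\<And>y. y \<in> S \<Longrightarrow> h (l y) = y [^]\<^bsub>H\<^esub> N"
    by metis
  have inj: "inj_on l S"
    using H.int_independent_inj_on_pow[OF S N] hl by (metis (mono_tags, lifting) inj_on_def)
  have "int_independent G (l ` S)"
    unfolding int_independent_def
  proof (intro conjI allI impI)
    fix c :: "'a \<Rightarrow> int"
    assume "finprod G (\<lambda>x. x [^]\<^bsub>G\<^esub> c x) (l ` S) = \<one>\<^bsub>G\<^esub>"
    then have "finprod G (\<lambda>y. l y [^]\<^bsub>G\<^esub> c (l y)) S = \<one>\<^bsub>G\<^esub>"
      using l inj by (subst (asm) G.finprod_reindex) auto
    then have "\<one>\<^bsub>H\<^esub> = h (finprod G (\<lambda>y. l y [^]\<^bsub>G\<^esub> c (l y)) S)"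
      by simp
    also have "\<dots> = finprod H (\<lambda>y. h (l y [^]\<^bsub>G\<^esub> c (l y))) S"
      using l by (intro hom_finprod assms) auto
    also have "\<dots> = finprod H (\<lambda>y. y [^]\<^bsub>H\<^esub> (N * c (l y))) S"
      using l car by (intro H.finprod_cong') (auto simp: hom_int_pow hl H.int_pow_pow)
    finally have "\<forall>y\<in>S. N * c (l y) = 0"
      by (intro indep) simp
    then show "\<forall>x\<in>l ` S. c x = 0"
      using N by simp
  qed (use fin l in auto)
  moreover have "card (l ` S) = card S"
    using inj by (rule card_image)
  ultimately show "\<exists>T\<in>{T. int_independent G T}. enat (card S) \<le> enat (card T)"
    by (intro bexI[of _ "l ` S"]) auto
qed

lemma (in group_hom) induced_hom_FactGroup:
  assumes M: "M \<lhd> G" and N: "N \<lhd> H" and "h ` M \<subseteq> N"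
  obtains g where "g \<in> hom (G Mod M) (H Mod N)"
    and "\<And>x. x \<in> carrier G \<Longrightarrow> g (M #>\<^bsub>G\<^esub> x) = N #>\<^bsub>H\<^esub> h x"
proof -
  interpret M: normal M G by fact
  interpret N: normal N H by fact
  have "(\<lambda>y. N #>\<^bsub>H\<^esub> y) \<circ> h \<in> hom G (H Mod N)"
    using homh N.r_coset_hom_Mod by (rule Group.hom_compose)
  then interpret q: group_hom G "H Mod N" "(\<lambda>y. N #>\<^bsub>H\<^esub> y) \<circ> h"
    using N.factorgroup_is_group by (simp add: group_hom_def group_hom_axioms_def)
  have "M \<subseteq> kernel G (H Mod N) ((\<lambda>y. N #>\<^bsub>H\<^esub> y) \<circ> h)"
    using assms(3) M.subset by (auto simp: kernel_def H.coset_join2 N.subgroup_axioms)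
  with M show thesis
    by (rule q.FactGroup_universal_kernel) (use that in auto)
qed

section \<open>Rescaling cochains\<close>

text \<open>The integral form of the scaling factor \<open>\<Prod>u\<in>A. k' u / k u\<close>, multiplied by the common
  denominator \<open>\<Prod>u\<in>V. k u\<close>.\<close>

definition mixed_weight :: "'a set \<Rightarrow> ('a \<Rightarrow> int) \<Rightarrow> ('a \<Rightarrow> int) \<Rightarrow> 'a set \<Rightarrow> int"
  where "mixed_weight V k k' A = (\<Prod>u\<in>V. if u \<in> A then k' u else k u)"

text \<open>The \<open>case_sum\<close> is the vertex set of a generator: \<open>{v}\<close> for a vertex \<open>v\<close>, and the edge
  itself for an edge. One formula thus covers the cochains of all degrees.\<close>

definition rescale :: "'a set \<Rightarrow> ('a \<Rightarrow> int) \<Rightarrow> ('a \<Rightarrow> int) \<Rightarrow>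
    (('a + 'a set) \<Rightarrow>\<^sub>0 int) \<Rightarrow> (('a + 'a set) \<Rightarrow>\<^sub>0 int)"
  where "rescale V k k' =
    frag_extend (\<lambda>z. frag_cmul (mixed_weight V k k' (case_sum (\<lambda>v. {v}) id z)) (frag_of z))"

lemma keys_rescale: "Poly_Mapping.keys (rescale V k k' x) \<subseteq> Poly_Mapping.keys x"
  unfolding rescale_def by (rule order_trans[OF keys_frag_extend]) auto

text \<open>The two factors at a generator with vertex set \<open>A\<close> make complementary choices between
  \<open>k u\<close> and \<open>k' u\<close> at each vertex, so their product is the same for all \<open>A\<close>.\<close>

lemma rescale_rescale:
  "rescale V k' k (rescale V k k' x) = frag_cmul (\<Prod>u\<in>V. k u * k' u) x"
proof -
  have weight: "mixed_weight V k k' A * mixed_weight V k' k A = (\<Prod>u\<in>V. k u * k' u)" for A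
    unfolding mixed_weight_def prod.distrib[symmetric] by (rule prod.cong) auto
  have diff: "frag_cmul c (a - b) = frag_cmul c a - frag_cmul c b" for c a b
    using frag_cmul_distrib2[of c "a - b" b] by (simp add: algebra_simps)
  show ?thesis
    using subset_UNIV
  proof (induction x rule: frag_induction)
    case (one z)
    show ?case
      using weight[of "case_sum (\<lambda>v. {v}) id z"]
      by (simp add: rescale_def frag_extend_cmul mult.commute)
  qed (simp_all add: rescale_def frag_extend_diff diff)
qed

lemma mixed_weight_insert:
  assumes "finite V" and "w \<in> V" and "w \<notin> A"
  shows "k w * mixed_weight V k k' (insert w A) = k' w * mixed_weight V k k' A"
proof -
  have "(\<Prod>u\<in>V - {w}. if u \<in> insert w A then k' u else k u) =
      (\<Prod>u\<in>V - {w}. if u \<in> A then k' u else k u)"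
    by (rule prod.cong) auto
  with assms show ?thesis
    by (simp add: mixed_weight_def prod.remove[of V w])
qed

text \<open>The cochain map identity at a generator. The coefficients of the edge \<open>{v, w}\<close> agree
  by \<open>mixed_weight_insert\<close>, which applies because the graph has no loops: \<open>w \<noteq> v\<close>.\<close>

lemma (in fin_simple_graph) vertex_coboundary_rescale:
  assumes "v \<in> V"
  shows "frag_cmul (mixed_weight V k k' {v}) (vertex_coboundary V E k' v) =
    rescale V k k' (vertex_coboundary V E k v)"
proof -
  have fin: "finite (neighbours V E v)"
    using finite_verts by (simp add: neighbours_def)
  have weight: "mixed_weight V k k' {v} * k' w = k w * mixed_weight V k k' {v, w}"
    if "w \<in> neighbours V E v" for w
  proof -
    have "w \<in> V" and "card {v, w} = 2"
      using that edges[of "{v, w}"] by (auto simp: neighbours_def)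
    then have "w \<notin> {v}"
      by auto
    with mixed_weight_insert[OF finite_verts \<open>w \<in> V\<close> this] show ?thesis
      by (simp add: insert_commute mult.commute)
  qed
  show ?thesis
    unfolding vertex_coboundary_def rescale_def
    by (simp add: frag_cmul_sum frag_extend_sum[OF fin] o_def frag_extend_cmul weight)
qed

lemma (in fin_simple_graph) coboundary_rescale:
  assumes "x \<in> carrier (cochain_group V E n)"
  shows "coboundary V E k' n (rescale V k k' x) = rescale V k k' (coboundary V E k n x)"
proof (cases "n = 0")
  case True
  with assms have "Poly_Mapping.keys x \<subseteq> Inl ` V"
    by (simp add: cochain_group_def cochain_basis_def)
  then show ?thesis
  proof (induction x rule: frag_induction)
    case (one z)
    then obtain v where "z = Inl v" "v \<in> V" by auto
    then show ?case
      using vertex_coboundary_rescale[of v k k'] True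
      by (simp add: coboundary_def rescale_def frag_extend_cmul)
  qed (use True in \<open>auto simp: coboundary_def rescale_def frag_extend_diff\<close>)
qed (simp add: coboundary_def rescale_def)

section \<open>The induced map on cohomology\<close>

abbreviation cocycle_group ::
    "'a set \<Rightarrow> 'a set set \<Rightarrow> ('a \<Rightarrow> int) \<Rightarrow> int \<Rightarrow> (('a + 'a set) \<Rightarrow>\<^sub>0 int) monoid"
  where "cocycle_group V E k n \<equiv> (cochain_group V E n)\<lparr>carrier := cocycles V E k n\<rparr>"

lemma cocycles_iff:
  "x \<in> cocycles V E k n \<longleftrightarrow> x \<in> carrier (cochain_group V E n) \<and> coboundary V E k n x = 0"
  by (simp add: cocycles_def kernel_def cochain_group_def)

lemma (in fin_simple_graph) subgroup_cocycles:
  "subgroup (cocycles V E k n) (cochain_group V E n)"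
proof -
  interpret group_hom "cochain_group V E n" "cochain_group V E (n + 1)" "coboundary V E k n"
    using coboundary_hom
    by (simp add: group_hom_def group_hom_axioms_def cochain_group_def)
  show ?thesis
    unfolding cocycles_def by (rule subgroup_kernel)
qed

lemma (in fin_simple_graph) comm_group_cocycle_group: "comm_group (cocycle_group V E k n)"
proof -
  interpret comm_group "cochain_group V E n"
    by (simp add: cochain_group_def abelian_free_Abelian_group)
  show ?thesis
    by (rule group.group_comm_groupI[OF subgroup_imp_group[OF subgroup_cocycles]])
       (auto simp: cocycles_iff m_comm)
qed

lemma (in fin_simple_graph) normal_coboundaries:
  "coboundaries V E k n \<lhd> cocycle_group V E k n"
proof -
  interpret C: group "cochain_group V E n"
    by (simp add: cochain_group_def)
  interpret d: group_hom "cochain_group V E (n - 1)" "cochain_group V E n" "coboundary V E k (n - 1)"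
    using coboundary_hom[of k "n - 1"]
    by (simp add: group_hom_def group_hom_axioms_def cochain_group_def)
  have "subgroup (coboundaries V E k n) (cochain_group V E n)"
    unfolding coboundaries_def by (rule d.img_is_subgroup)
  moreover have "coboundaries V E k n \<subseteq> cocycles V E k n"
    using coboundary_coboundary[of V E k "n - 1"]
    by (auto simp: coboundaries_def cocycles_iff)
  ultimately have "subgroup (coboundaries V E k n) (cocycle_group V E k n)"
    using C.subgroup_incl subgroup_cocycles by blast
  then show ?thesis
    by (rule comm_group.subgroup_imp_normal[OF comm_group_cocycle_group])
qed

lemma (in fin_simple_graph) rescale_cocycles:
  assumes "x \<in> cocycles V E k n"
  shows "rescale V k k' x \<in> cocycles V E k' n"
  using assms keys_rescale[of V k k' x] coboundary_rescale[of x n k' k]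
  by (auto simp: cocycles_iff cochain_group_def rescale_def)

lemma (in fin_simple_graph) rescale_coboundaries:
  "rescale V k k' ` coboundaries V E k n \<subseteq> coboundaries V E k' n"
proof
  fix y assume "y \<in> rescale V k k' ` coboundaries V E k n"
  then obtain x where x: "x \<in> carrier (cochain_group V E (n - 1))"
    and y: "y = rescale V k k' (coboundary V E k (n - 1) x)"
    by (auto simp: coboundaries_def)
  have "y = coboundary V E k' (n - 1) (rescale V k k' x)"
    using coboundary_rescale[OF x] y by simp
  moreover have "rescale V k k' x \<in> carrier (cochain_group V E (n - 1))"
    using x keys_rescale[of V k k' x] by (auto simp: cochain_group_def)
  ultimately show "y \<in> coboundaries V E k' n"
    by (simp add: coboundaries_def)
qed

lemma (in fin_simple_graph) int_pow_cocycle_group: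
  assumes "x \<in> cocycles V E k n"
  shows "x [^]\<^bsub>cocycle_group V E k n\<^esub> (N::int) = frag_cmul N x"
proof -
  interpret C: group "cochain_group V E n"
    by (simp add: cochain_group_def)
  have "x [^]\<^bsub>cocycle_group V E k n\<^esub> N = x [^]\<^bsub>cochain_group V E n\<^esub> N"
    using C.int_pow_consistent[OF subgroup_cocycles assms] by simp
  also have "\<dots> = frag_cmul N x"
    using assms by (simp add: cocycles_iff cochain_group_def)
  finally show ?thesis .
qed

text \<open>Rescaling from \<open>k\<close> to \<open>k'\<close> induces a map of cohomology groups, and rescaling back from
  \<open>k'\<close> to \<open>k\<close> provides, at the level of cocycles, a preimage of \<open>N\<close> times any class.\<close>

lemma (in fin_simple_graph) group_rank_cohomology_group_le:
  assumes "\<And>v. v \<in> V \<Longrightarrow> k v \<noteq> 0" and "\<And>v. v \<in> V \<Longrightarrow> k' v \<noteq> 0"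
  shows "group_rank (cohomology_group V E k' n) \<le> group_rank (cohomology_group V E k n)"
proof -
  let ?Z = "cocycle_group V E k n" and ?Z' = "cocycle_group V E k' n"
  let ?B = "coboundaries V E k n" and ?B' = "coboundaries V E k' n"
  let ?N = "\<Prod>u\<in>V. k' u * k u"
  interpret Z: comm_group ?Z by (rule comm_group_cocycle_group)
  interpret Z': comm_group ?Z' by (rule comm_group_cocycle_group)
  interpret B': normal ?B' ?Z' by (rule normal_coboundaries)
  have "rescale V k k' \<in> hom ?Z ?Z'"
    using rescale_cocycles
    by (auto simp: hom_def cochain_group_def) (simp add: rescale_def frag_extend_add)
  then interpret r: group_hom ?Z ?Z' "rescale V k k'"
    by unfold_locales
  obtain g where g: "g \<in> hom (cohomology_group V E k n) (cohomology_group V E k' n)"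
    and g_coset: "\<And>x. x \<in> cocycles V E k n \<Longrightarrow>
      g (?B #>\<^bsub>?Z\<^esub> x) = ?B' #>\<^bsub>?Z'\<^esub> rescale V k k' x"
    using r.induced_hom_FactGroup[OF normal_coboundaries normal_coboundaries rescale_coboundaries]
    unfolding cohomology_group_def by auto
  interpret g: group_hom "cohomology_group V E k n" "cohomology_group V E k' n" g
    using g comm_group_cohomology_group
    by (simp add: group_hom_def group_hom_axioms_def comm_group_def)
  show ?thesis
  proof (rule g.group_rank_le_of_torsion_cokernel[OF comm_group_cohomology_group
        comm_group_cohomology_group])
    show "?N \<noteq> 0"
      using assms finite_verts by simp
    fix Y assume "Y \<in> carrier (cohomology_group V E k' n)"
    then obtain y where y: "y \<in> cocycles V E k' n" and Y: "Y = ?B' #>\<^bsub>?Z'\<^esub> y"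
      by (auto simp: cohomology_group_def carrier_FactGroup)
    have x: "rescale V k' k y \<in> cocycles V E k n"
      using y by (rule rescale_cocycles)
    have "g (?B #>\<^bsub>?Z\<^esub> rescale V k' k y) = ?B' #>\<^bsub>?Z'\<^esub> (y [^]\<^bsub>?Z'\<^esub> ?N)"
      unfolding g_coset[OF x] rescale_rescale int_pow_cocycle_group[OF y] ..
    also have "\<dots> = Y [^]\<^bsub>cohomology_group V E k' n\<^esub> ?N"
      unfolding Y cohomology_group_def
      by (rule B'.FactGroup_int_pow[symmetric]) (simp add: y)
    finally show "\<exists>x\<in>carrier (cohomology_group V E k n).
        g x = Y [^]\<^bsub>cohomology_group V E k' n\<^esub> ?N"
      using x by (auto simp: cohomology_group_def carrier_FactGroup)
  qed
qed

theorem corollary2: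
  fixes V :: "'a set" and E :: "'a set set" and k k' :: "'a \<Rightarrow> int" and n :: int
  assumes "fin_simple_graph V E"
    and "\<And>v. v \<in> V \<Longrightarrow> k v > 0"
    and "\<And>v. v \<in> V \<Longrightarrow> k' v > 0"
  shows "group_rank (cohomology_group V E k n) = group_rank (cohomology_group V E k' n)"
proof -
  interpret fin_simple_graph V E by fact
  have "\<And>v. v \<in> V \<Longrightarrow> k v \<noteq> 0" and "\<And>v. v \<in> V \<Longrightarrow> k' v \<noteq> 0"
    using assms(2,3) by force+
  then show ?thesis
    by (intro antisym group_rank_cohomology_group_le)
qed

end
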